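(* Let $d \ge 2$ be a fixed integer, let $B(\cdot,\cdot)$ be a non-degenerate bilinear form on $\mathbb{F}_q^d$, and let $\mathcal{E} \subset \mathbb{F}_q^d$ have cardinality $|\mathcal{E}| \gg q^{(d+1)/2}$. Then there exists a subset $\mathcal{E}' \subset \mathcal{E}$ with cardinality $|\mathcal{E}'| = (1-o(1))|\mathcal{E}|$ such that for every $\boldsymbol{y} \in \mathcal{E}'$ one has $|B_{\boldsymbol{y}}(\mathcal{E})| = (1-o(1))q$.
   Context: $q$ is a power of an odd prime, viewed as an asymptotic parameter: $q\to\infty$, the set $\mathcal{E}$ and the form $B$ may depend on $q$, and $o(1)$ denotes a quantity tending to $0$ as $q\to\infty$ (uniformly in $\boldsymbol{y}\in\mathcal{E}'$). $X \ll Y$ (equivalently $Y \gg X$) means $X = o(Y)$. The pinned product set is $B_{\boldsymbol{y}}(\mathcal{E}) = \{B(\boldsymbol{x},\boldsymbol{y}) : \boldsymbol{x} \in \mathcal{E}\}\subset\mathbb{F}_q$. *)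

theory Defs
  imports
    Complex_Main
    "HOL-Computational_Algebra.Primes"
    "HOL-Library.Landau_Symbols"
    "HOL-Algebra.Module"
begin

text \<open>
  The order \<open>q\<close> of the ground field varies within the statement, so fields are records with a
  carrier rather than instances of a type class, and vectors with \<open>d\<close> coordinates are extensional
  functions on \<open>{..<d}\<close>. The library's module records extend ring records; the multiplicative
  fields \<open>mult\<close> and \<open>one\<close> are taken componentwise and play no role below.
\<close>

definition coord_space :: "('a, 'm) ring_scheme \<Rightarrow> nat \<Rightarrow> ('a, nat \<Rightarrow> 'a) module" where
  "coord_space R d =
    \<lparr>carrier = {..<d} \<rightarrow>\<^sub>E carrier R,
     mult = \<lambda>x y. \<lambda>i\<in>{..<d}. x i \<otimes>\<^bsub>R\<^esub> y i,
     one = \<lambda>i\<in>{..<d}. \<one>\<^bsub>R\<^esub>,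
     zero = \<lambda>i\<in>{..<d}. \<zero>\<^bsub>R\<^esub>,
     add = \<lambda>x y. \<lambda>i\<in>{..<d}. x i \<oplus>\<^bsub>R\<^esub> y i,
     smult = \<lambda>c x. \<lambda>i\<in>{..<d}. c \<otimes>\<^bsub>R\<^esub> x i\<rparr>"

lemma coord_space_module:
  assumes "cring R"
  shows "Module.module R (coord_space R d)"
proof -
  interpret cring R by (rule assms)
  have "abelian_group (coord_space R d)"
  proof (rule abelian_groupI)
    fix x assume x: "x \<in> carrier (coord_space R d)"
    have "(\<lambda>i\<in>{..<d}. \<ominus>\<^bsub>R\<^esub> x i) \<in> carrier (coord_space R d)"
      using x by (auto simp: coord_space_def)
    moreover have "(\<lambda>i\<in>{..<d}. \<ominus>\<^bsub>R\<^esub> x i) \<oplus>\<^bsub>coord_space R d\<^esub> x = \<zero>\<^bsub>coord_space R d\<^esub>"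
      using x by (auto simp: coord_space_def PiE_iff l_neg intro!: restrict_ext)
    ultimately show "\<exists>y\<in>carrier (coord_space R d).
        y \<oplus>\<^bsub>coord_space R d\<^esub> x = \<zero>\<^bsub>coord_space R d\<^esub>" by blast
  next
    fix x assume "x \<in> carrier (coord_space R d)"
    then show "\<zero>\<^bsub>coord_space R d\<^esub> \<oplus>\<^bsub>coord_space R d\<^esub> x = x"
      by (auto simp: coord_space_def PiE_iff extensional_def fun_eq_iff)
  qed (auto simp: coord_space_def PiE_iff a_assoc intro!: restrict_ext a_comm)
  then show ?thesis
    by (intro moduleI assms)
       (auto simp: coord_space_def PiE_iff l_distr r_distr m_assoc extensional_def fun_eq_iff)
qed

definition bilinear_form ::
  "('a, 'm) ring_scheme \<Rightarrow> ('a, 'v, 'n) module_scheme \<Rightarrow> ('v \<Rightarrow> 'v \<Rightarrow> 'a) \<Rightarrow> bool" where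
  "bilinear_form R V B \<longleftrightarrow>
    (\<forall>x\<in>carrier V. \<forall>y\<in>carrier V. B x y \<in> carrier R) \<and>
    (\<forall>x\<in>carrier V. \<forall>x'\<in>carrier V. \<forall>y\<in>carrier V.
      B (x \<oplus>\<^bsub>V\<^esub> x') y = B x y \<oplus>\<^bsub>R\<^esub> B x' y) \<and>
    (\<forall>x\<in>carrier V. \<forall>y\<in>carrier V. \<forall>y'\<in>carrier V.
      B x (y \<oplus>\<^bsub>V\<^esub> y') = B x y \<oplus>\<^bsub>R\<^esub> B x y') \<and>
    (\<forall>c\<in>carrier R. \<forall>x\<in>carrier V. \<forall>y\<in>carrier V.
      B (c \<odot>\<^bsub>V\<^esub> x) y = c \<otimes>\<^bsub>R\<^esub> B x y) \<and>
    (\<forall>c\<in>carrier R. \<forall>x\<in>carrier V. \<forall>y\<in>carrier V.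
      B x (c \<odot>\<^bsub>V\<^esub> y) = c \<otimes>\<^bsub>R\<^esub> B x y)"

text \<open>Symmetry is not assumed, so both the left and the right radical are required to be trivial.\<close>

definition nondegenerate ::
  "('a, 'm) ring_scheme \<Rightarrow> ('a, 'v, 'n) module_scheme \<Rightarrow> ('v \<Rightarrow> 'v \<Rightarrow> 'a) \<Rightarrow> bool" where
  "nondegenerate R V B \<longleftrightarrow>
    (\<forall>x\<in>carrier V. (\<forall>y\<in>carrier V. B x y = \<zero>\<^bsub>R\<^esub>) \<longrightarrow> x = \<zero>\<^bsub>V\<^esub>) \<and>
    (\<forall>y\<in>carrier V. (\<forall>x\<in>carrier V. B x y = \<zero>\<^bsub>R\<^esub>) \<longrightarrow> y = \<zero>\<^bsub>V\<^esub>)"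

definition pinned_product_set :: "('v \<Rightarrow> 'v \<Rightarrow> 'a) \<Rightarrow> 'v set \<Rightarrow> 'v \<Rightarrow> 'a set" where
  "pinned_product_set B E y = {B x y |x. x \<in> E}"

end

theory Submission
  imports Defs
begin

text \<open>
  The functionals \<open>x \<mapsto> B x y\<close>, indexed by all \<open>y\<close> in the space \<open>V\<close>, form a universal family of
  hash functions: two distinct points \<open>x\<close>, \<open>x'\<close> take the same value for at most a proportion
  \<open>1 / q\<close> of the indices, because those indices form the kernel of the nonzero functional
  \<open>B (x - x')\<close> (lemma \<open>card_collisions_le\<close>). A second moment computation then shows that the
  fibres of \<open>E\<close> have nearly equal size for most \<open>y\<close>, and a value that is missed costs
  \<open>(|E| / q)\<^sup>2\<close> in the variance. Summed over the whole space, the number of missed values is at most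
  \<open>q\<^sup>2 |V| / |E|\<close> (lemma \<open>sum_missed_values_le\<close>).

  All terms are nonnegative, so the same bound \<open>q ^ (d + 2) / |E|\<close> holds for the sum over \<open>y \<in> E\<close>
  alone. On average a point of \<open>E\<close> therefore misses at most \<open>q \<epsilon>\<^sup>2\<close> values, where
  \<open>\<epsilon> = q powr ((d + 1) / 2) / |E|\<close>, and the hypothesis on \<open>|E|\<close> says precisely that \<open>\<epsilon> \<rightarrow> 0\<close>. By
  Markov's inequality at most \<open>\<epsilon> |E|\<close> points of \<open>E\<close> miss more than \<open>\<epsilon> q\<close> values; \<open>E'\<close> consists of
  the others.
\<close>

text \<open>
  Since fibre sizes add up to the size of the domain, subtracting the mean turns the sum of their
  squares into a variance; each empty fibre contributes the square of the mean to it. Everything is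
  scaled by \<open>card T\<close> to avoid division.
\<close>
lemma missed_values_le_variance:
  fixes h :: "'x \<Rightarrow> 't"
  assumes "finite E" "finite T" "h ` E \<subseteq> T"
  shows "real (card (T - h ` E)) * real (card E) ^ 2 \<le>
    real (card T) ^ 2 * (\<Sum>x\<in>E. real (card {x'\<in>E. h x = h x'})) - real (card T) * real (card E) ^ 2"
proof -
  let ?q = "real (card T)" and ?m = "real (card E)"
  define f where "f t = real (card {x\<in>E. h x = t})" for t
  have sum_f: "(\<Sum>t\<in>T. f t) = ?m"
  proof -
    have "(\<Sum>t\<in>T. card {x\<in>E. h x = t}) = card E"
      using sum.group[OF assms, of "\<lambda>_. 1::nat"] by simp
    then show ?thesis unfolding f_def by (simp flip: of_nat_sum)
  qed
  have sum_f2: "(\<Sum>t\<in>T. (f t) ^ 2) = (\<Sum>x\<in>E. real (card {x'\<in>E. h x = h x'}))"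
  proof -
    have "(\<Sum>x\<in>E. real (card {x'\<in>E. h x = h x'})) = (\<Sum>x\<in>E. f (h x))"
      unfolding f_def by (intro sum.cong refl) (simp add: eq_commute)
    also have "\<dots> = (\<Sum>t\<in>T. \<Sum>x\<in>{x\<in>E. h x = t}. f (h x))"
      by (rule sum.group[OF assms, symmetric])
    also have "\<dots> = (\<Sum>t\<in>T. (f t) ^ 2)"
      by (intro sum.cong refl) (simp add: f_def power2_eq_square)
    finally show ?thesis ..
  qed
  have "real (card (T - h ` E)) * ?m ^ 2 = (\<Sum>t\<in>T - h ` E. (?q * f t - ?m) ^ 2)"
  proof -
    have "f t = 0" if "t \<in> T - h ` E" for t
      using that assms(1) by (auto simp: f_def)
    then show ?thesis by simp
  qed
  also have "\<dots> \<le> (\<Sum>t\<in>T. (?q * f t - ?m) ^ 2)"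
    using assms(2) by (intro sum_mono2) auto
  also have "\<dots> = ?q ^ 2 * (\<Sum>t\<in>T. (f t) ^ 2) - 2 * ?q * ?m * (\<Sum>t\<in>T. f t) + ?q * ?m ^ 2"
  proof -
    have "(?q * f t - ?m) ^ 2 = ?q ^ 2 * (f t) ^ 2 - 2 * ?q * ?m * f t + ?m ^ 2" for t
      by (simp add: power2_eq_square algebra_simps)
    then show ?thesis by (simp add: sum.distrib sum_subtractf sum_distrib_left mult.assoc)
  qed
  also have "\<dots> = ?q ^ 2 * (\<Sum>x\<in>E. real (card {x'\<in>E. h x = h x'})) - ?q * ?m ^ 2"
    unfolding sum_f sum_f2 by (simp add: power2_eq_square algebra_simps)
  finally show ?thesis .
qed

text \<open>
  For a universal family the total number of collisions is at most its diagonal part \<open>|E| |Y|\<close> plus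
  the expected off-diagonal part \<open>|E|\<^sup>2 |Y| / |T|\<close>. The latter cancels against the square of the mean,
  so only the diagonal is left to bound the variance.
\<close>
lemma sum_missed_values_le:
  fixes h :: "'x \<Rightarrow> 'y \<Rightarrow> 't"
  assumes fin: "finite E" "finite Y" "finite T"
    and range: "\<And>x y. x \<in> E \<Longrightarrow> y \<in> Y \<Longrightarrow> h x y \<in> T"
    and universal: "\<And>x x'. x \<in> E \<Longrightarrow> x' \<in> E \<Longrightarrow> x \<noteq> x' \<Longrightarrow>
      card T * card {y\<in>Y. h x y = h x' y} \<le> card Y"
  shows "(\<Sum>y\<in>Y. real (card (T - (\<lambda>x. h x y) ` E))) * real (card E) \<le>
    real (card T) ^ 2 * real (card Y)"
proof (cases "E = {}")
  case False
  let ?q = "real (card T)" and ?m = "real (card E)" and ?N = "real (card Y)"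
  have m_pos: "?m > 0" using False fin(1) by (simp add: card_gt_0_iff)
  have swap: "(\<Sum>y\<in>Y. \<Sum>x\<in>E. real (card {x'\<in>E. h x y = h x' y})) =
      (\<Sum>x\<in>E. \<Sum>x'\<in>E. real (card {y\<in>Y. h x y = h x' y}))"
  proof -
    have "(\<Sum>y\<in>Y. \<Sum>x\<in>E. real (card {x'\<in>E. h x y = h x' y})) =
        (\<Sum>x\<in>E. \<Sum>y\<in>Y. real (card {x'\<in>E. h x y = h x' y}))"
      by (rule sum.swap)
    also have "\<dots> = (\<Sum>x\<in>E. \<Sum>y\<in>Y. \<Sum>x'\<in>E. of_bool (h x y = h x' y))"
      using fin by (simp add: Int_def)
    also have "\<dots> = (\<Sum>x\<in>E. \<Sum>x'\<in>E. \<Sum>y\<in>Y. of_bool (h x y = h x' y))"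
      by (intro sum.cong refl sum.swap)
    finally show ?thesis using fin by (simp add: Int_def)
  qed
  have collisions: "?q * (\<Sum>x'\<in>E. real (card {y\<in>Y. h x y = h x' y})) \<le> ?q * ?N + ?m * ?N"
    if x: "x \<in> E" for x
  proof -
    have "?q * real (card {y\<in>Y. h x y = h x' y}) \<le> (if x' = x then ?q * ?N else 0) + ?N"
      if "x' \<in> E" for x'
    proof (cases "x' = x")
      case False
      then have "real (card T * card {y\<in>Y. h x y = h x' y}) \<le> ?N"
        using universal[OF x that] by (intro of_nat_mono) auto
      then show ?thesis using False by simp
    qed simp
    then have "(\<Sum>x'\<in>E. ?q * real (card {y\<in>Y. h x y = h x' y})) \<le>
        (\<Sum>x'\<in>E. (if x' = x then ?q * ?N else 0) + ?N)"
      by (intro sum_mono)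
    also have "\<dots> = ?q * ?N + ?m * ?N"
      using fin(1) x by (simp add: sum.distrib)
    finally show ?thesis by (simp add: sum_distrib_left)
  qed
  have "(\<Sum>y\<in>Y. real (card (T - (\<lambda>x. h x y) ` E))) * ?m ^ 2 =
      (\<Sum>y\<in>Y. real (card (T - (\<lambda>x. h x y) ` E)) * ?m ^ 2)"
    by (simp add: sum_distrib_right)
  also have "\<dots> \<le> (\<Sum>y\<in>Y. ?q ^ 2 * (\<Sum>x\<in>E. real (card {x'\<in>E. h x y = h x' y})) - ?q * ?m ^ 2)"
    using fin range by (intro sum_mono missed_values_le_variance) auto
  also have "\<dots> = ?q * (\<Sum>x\<in>E. ?q * (\<Sum>x'\<in>E. real (card {y\<in>Y. h x y = h x' y}))) - ?q * ?m ^ 2 * ?N"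
    unfolding sum_subtractf sum_distrib_left[symmetric] swap
    by (simp add: power2_eq_square mult_ac)
  also have "\<dots> \<le> ?q * (\<Sum>x\<in>E. ?q * ?N + ?m * ?N) - ?q * ?m ^ 2 * ?N"
    using collisions by (intro diff_right_mono mult_left_mono sum_mono) auto
  also have "\<dots> = (?q ^ 2 * ?N) * ?m"
    by (simp add: power2_eq_square algebra_simps)
  finally have "((\<Sum>y\<in>Y. real (card (T - (\<lambda>x. h x y) ` E))) * ?m) * ?m \<le> (?q ^ 2 * ?N) * ?m"
    by (simp add: power2_eq_square mult_ac)
  then show ?thesis using m_pos by (rule mult_right_le_imp_le)
qed simp

text \<open>
  The indices at which \<open>x\<close> and \<open>x'\<close> collide form the kernel of \<open>B v\<close> with \<open>v = x - x'\<close>. If \<open>y\<^sub>0\<close> is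
  outside this kernel, its translates along the line spanned by \<open>y\<^sub>0\<close> are disjoint, so the kernel
  times the field embeds into \<open>V\<close>.
\<close>
lemma card_collisions_le:
  assumes "field R" "Module.module R V" and fin: "finite (carrier V)"
    and bil: "bilinear_form R V B" and nondeg: "nondegenerate R V B"
    and x: "x \<in> carrier V" and x': "x' \<in> carrier V" and neq: "x \<noteq> x'"
  shows "card (carrier R) * card {y\<in>carrier V. B x y = B x' y} \<le> card (carrier V)"
proof -
  interpret R: field R by fact
  interpret V: module R V by fact
  have B_closed: "B u y \<in> carrier R" if "u \<in> carrier V" "y \<in> carrier V" for u y
    using bil that by (simp add: bilinear_form_def)
  define v where "v = x \<ominus>\<^bsub>V\<^esub> x'"
  have v: "v \<in> carrier V" using x x' by (simp add: v_def)
  have v_add: "v \<oplus>\<^bsub>V\<^esub> x' = x"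
    using x x' by (simp add: v_def V.minus_eq V.a_assoc V.l_neg)
  have "v \<noteq> \<zero>\<^bsub>V\<^esub>" using v_add neq x' by auto
  then obtain y0 where y0: "y0 \<in> carrier V" and b: "B v y0 \<noteq> \<zero>\<^bsub>R\<^esub>"
    using nondeg v by (auto simp: nondegenerate_def)
  define K where "K = {y\<in>carrier V. B x y = B x' y}"
  have kernel: "B v y = \<zero>\<^bsub>R\<^esub>" if "y \<in> K" for y
  proof -
    have y: "y \<in> carrier V" and eq: "B x y = B x' y" using that by (auto simp: K_def)
    have "B (v \<oplus>\<^bsub>V\<^esub> x') y = B v y \<oplus>\<^bsub>R\<^esub> B x' y"
      using bil v x' y by (simp add: bilinear_form_def)
    then have "B v y \<oplus>\<^bsub>R\<^esub> B x' y = B x y"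
      by (simp add: v_add)
    then show ?thesis
      using R.add.r_cancel_one[of "B x' y" "B v y"] B_closed[OF v y] B_closed[OF x' y] eq by simp
  qed
  have line: "B v (y \<oplus>\<^bsub>V\<^esub> c \<odot>\<^bsub>V\<^esub> y0) = c \<otimes>\<^bsub>R\<^esub> B v y0" if "c \<in> carrier R" "y \<in> K" for c y
  proof -
    have "y \<in> carrier V" using that by (simp add: K_def)
    then have "B v (y \<oplus>\<^bsub>V\<^esub> c \<odot>\<^bsub>V\<^esub> y0) = B v y \<oplus>\<^bsub>R\<^esub> c \<otimes>\<^bsub>R\<^esub> B v y0"
      using bil v y0 that by (simp add: bilinear_form_def)
    then show ?thesis using kernel that B_closed v y0 by simp
  qed
  have "inj_on (\<lambda>(c, y). y \<oplus>\<^bsub>V\<^esub> c \<odot>\<^bsub>V\<^esub> y0) (carrier R \<times> K)"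
  proof (rule inj_onI, clarify)
    fix c y c' y'
    assume c: "c \<in> carrier R" "c' \<in> carrier R" and y: "y \<in> K" "y' \<in> K"
      and eq: "y \<oplus>\<^bsub>V\<^esub> c \<odot>\<^bsub>V\<^esub> y0 = y' \<oplus>\<^bsub>V\<^esub> c' \<odot>\<^bsub>V\<^esub> y0"
    have "c \<otimes>\<^bsub>R\<^esub> B v y0 = c' \<otimes>\<^bsub>R\<^esub> B v y0" using line[OF c(1) y(1)] line[OF c(2) y(2)] eq by simp
    then have "c = c'" using R.m_rcancel[of "B v y0" c c'] b B_closed v y0 c by simp
    then show "c = c' \<and> y = y'"
      using eq y c y0 by (simp add: K_def)
  qed
  moreover have "(\<lambda>(c, y). y \<oplus>\<^bsub>V\<^esub> c \<odot>\<^bsub>V\<^esub> y0) ` (carrier R \<times> K) \<subseteq> carrier V"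
    using y0 by (auto simp: K_def)
  ultimately have "card (carrier R \<times> K) \<le> card (carrier V)"
    using fin by (rule card_inj_on_le)
  then show ?thesis by (simp add: card_cartesian_product K_def)
qed

text \<open>
  Markov's inequality. The threshold is the \<open>\<epsilon>\<close> at which the two error terms of the theorem, the
  proportion of discarded points and the proportion of missed values, coincide.
\<close>
lemma card_many_missed_values_le:
  fixes d :: nat and R :: "('a, 'm) ring_scheme"
  assumes R: "field R" "finite (carrier R)"
    and bil: "bilinear_form R (coord_space R d) B"
    and nondeg: "nondegenerate R (coord_space R d) B"
    and E: "E \<subseteq> carrier (coord_space R d)"
  defines "q \<equiv> real (card (carrier R))"
  defines "\<epsilon> \<equiv> q powr ((real d + 1) / 2) / real (card E)"
  shows "real (card {y\<in>E. real (card (carrier R - (\<lambda>x. B x y) ` E)) > \<epsilon> * q}) \<le> \<epsilon> * real (card E)"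
proof (cases "E = {}")
  case False
  interpret R: field R by fact
  let ?V = "carrier (coord_space R d)" and ?m = "real (card E)"
  let ?miss = "\<lambda>y. real (card (carrier R - (\<lambda>x. B x y) ` E))"
  define Z where "Z = {y\<in>E. ?miss y > \<epsilon> * q}"
  have finV: "finite ?V" using R(2) by (simp add: coord_space_def finite_PiE)
  have cardV: "real (card ?V) = q ^ d" by (simp add: coord_space_def card_PiE q_def)
  have finE: "finite E" using E finV by (rule finite_subset)
  have m_pos: "?m > 0" using False finE by (simp add: card_gt_0_iff)
  have q_pos: "q > 0" using R.zero_closed R(2) by (auto simp: q_def card_gt_0_iff)
  have \<epsilon>_pos: "\<epsilon> > 0" using m_pos q_pos by (simp add: \<epsilon>_def)
  have \<epsilon>_sq: "(\<epsilon> * ?m) ^ 2 = q ^ (d + 1)"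
  proof -
    have "(\<epsilon> * ?m) ^ 2 = q powr (real d + 1)"
      using m_pos by (simp add: \<epsilon>_def power2_eq_square flip: powr_add)
    also have "\<dots> = q ^ (d + 1)" using q_pos by (simp add: powr_realpow powr_add)
    finally show ?thesis .
  qed
  have "real (card Z) * (\<epsilon> * q) = (\<Sum>y\<in>Z. \<epsilon> * q)" by simp
  also have "\<dots> \<le> (\<Sum>y\<in>Z. ?miss y)" by (intro sum_mono) (auto simp: Z_def)
  also have "\<dots> \<le> (\<Sum>y\<in>?V. ?miss y)"
    using finV E by (intro sum_mono2) (auto simp: Z_def)
  finally have "real (card Z) * (\<epsilon> * q) * ?m \<le> (\<Sum>y\<in>?V. ?miss y) * ?m"
    by (rule mult_right_mono) simp
  also have "\<dots> \<le> (real (card (carrier R))) ^ 2 * real (card ?V)"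
  proof (rule sum_missed_values_le[OF finE finV R(2)])
    show "B x y \<in> carrier R" if "x \<in> E" "y \<in> ?V" for x y
      using bil E that by (auto simp: bilinear_form_def)
    show "card (carrier R) * card {y\<in>?V. B x y = B x' y} \<le> card ?V"
      if "x \<in> E" "x' \<in> E" "x \<noteq> x'" for x x'
      using E that
      by (intro card_collisions_le[OF R(1) coord_space_module[OF R.cring_axioms] finV bil nondeg]) auto
  qed
  also have "\<dots> = q * (\<epsilon> * ?m) ^ 2"
    unfolding \<epsilon>_sq cardV by (simp add: q_def power2_eq_square)
  finally have "real (card Z) * (\<epsilon> * q * ?m) \<le> (\<epsilon> * ?m) * (\<epsilon> * q * ?m)"
    by (simp add: power2_eq_square mult_ac)
  then have "real (card Z) \<le> \<epsilon> * ?m"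
    by (rule mult_right_le_imp_le) (use \<epsilon>_pos q_pos m_pos in simp)
  then show ?thesis by (simp add: Z_def)
qed simp

theorem theorem2p14:
  fixes d :: nat
    and F :: "nat \<Rightarrow> 'a ring"
    and q :: "nat \<Rightarrow> nat"
    and B :: "nat \<Rightarrow> (nat \<Rightarrow> 'a) \<Rightarrow> (nat \<Rightarrow> 'a) \<Rightarrow> 'a"
    and E :: "nat \<Rightarrow> (nat \<Rightarrow> 'a) set"
  assumes "d \<ge> 2"
    and "\<And>n. \<exists>p k. prime p \<and> odd p \<and> k \<ge> 1 \<and> q n = p ^ k"
    and "filterlim q at_top sequentially"
    and "\<And>n. field (F n)"
    and "\<And>n. finite (carrier (F n))"
    and "\<And>n. card (carrier (F n)) = q n"
    and "\<And>n. bilinear_form (F n) (coord_space (F n) d) (B n)"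
    and "\<And>n. nondegenerate (F n) (coord_space (F n) d) (B n)"
    and "\<And>n. E n \<subseteq> carrier (coord_space (F n) d)"
    and "(\<lambda>n. real (q n) powr ((real d + 1) / 2)) \<in> o(\<lambda>n. real (card (E n)))"
  shows "\<exists>E' :: nat \<Rightarrow> (nat \<Rightarrow> 'a) set. \<exists>\<delta> \<in> o(\<lambda>_. 1 :: real). \<exists>\<epsilon> \<in> o(\<lambda>_. 1 :: real).
    (\<forall>n. E' n \<subseteq> E n \<and>
         real (card (E' n)) = (1 - \<delta> n) * real (card (E n)) \<and>
         (\<forall>y \<in> E' n. \<bar>real (card (pinned_product_set (B n) (E n) y)) - real (q n)\<bar> \<le> \<epsilon> n * real (q n)))"
proof -
  define \<epsilon> where "\<epsilon> n = real (q n) powr ((real d + 1) / 2) / real (card (E n))" for n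
  define miss where "miss n y = real (card (carrier (F n) - (\<lambda>x. B n x y) ` E n))" for n y
  define Z where "Z n = {y\<in>E n. miss n y > \<epsilon> n * real (q n)}" for n
  define E' where "E' n = E n - Z n" for n
  \<comment> \<open>If \<open>E n\<close> is empty, the value \<open>x / 0 = 0\<close> gives \<open>\<epsilon> n = \<delta> n = 0\<close>, and all claims hold trivially.\<close>
  define \<delta> where "\<delta> n = real (card (Z n)) / real (card (E n))" for n
  have finE: "finite (E n)" for n
    using assms(9)[of n] by (rule finite_subset) (simp add: assms(5) coord_space_def finite_PiE)
  have \<epsilon>_lim: "\<epsilon> \<in> o(\<lambda>_. 1)"
    unfolding \<epsilon>_def using smalloD_tendsto[OF assms(10)] by (intro smalloI_tendsto) simp_all
  have Z_le: "real (card (Z n)) \<le> \<epsilon> n * real (card (E n))" for n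
    using card_many_missed_values_le[OF assms(4)[of n] assms(5) assms(7) assms(8) assms(9)]
    unfolding Z_def miss_def \<epsilon>_def assms(6) .
  have \<delta>_le: "\<delta> n \<le> \<epsilon> n" for n
    using Z_le[of n] by (cases "card (E n) = 0") (simp_all add: \<delta>_def \<epsilon>_def field_simps)
  have "\<delta> \<in> O(\<epsilon>)"
  proof (rule landau_o.big_mono, intro always_eventually allI)
    fix n
    have "0 \<le> \<delta> n" by (simp add: \<delta>_def)
    then show "norm (\<delta> n) \<le> norm (\<epsilon> n)" using \<delta>_le[of n] by simp
  qed
  then have \<delta>_lim: "\<delta> \<in> o(\<lambda>_. 1)" using \<epsilon>_lim by (rule landau_o.big_small_trans)
  have card_E': "real (card (E' n)) = (1 - \<delta> n) * real (card (E n))" for n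
  proof -
    have "Z n \<subseteq> E n" by (auto simp: Z_def)
    then have "real (card (E' n)) = real (card (E n)) - real (card (Z n))"
      unfolding E'_def using finE[of n]
      by (simp add: card_Diff_subset finite_subset card_mono of_nat_diff)
    moreover have "real (card (Z n)) = \<delta> n * real (card (E n))"
      using \<open>Z n \<subseteq> E n\<close> finE[of n] by (cases "E n = {}") (auto simp: \<delta>_def)
    ultimately show ?thesis by (simp add: algebra_simps)
  qed
  have pinned: "\<bar>real (card (pinned_product_set (B n) (E n) y)) - real (q n)\<bar> \<le> \<epsilon> n * real (q n)"
    if y: "y \<in> E' n" for n y
  proof -
    have image: "pinned_product_set (B n) (E n) y = (\<lambda>x. B n x y) ` E n"
      by (auto simp: pinned_product_set_def)
    have "y \<in> carrier (coord_space (F n) d)" using y assms(9) by (auto simp: E'_def)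
    then have sub: "(\<lambda>x. B n x y) ` E n \<subseteq> carrier (F n)"
      using assms(7)[of n] assms(9)[of n] by (auto simp: bilinear_form_def)
    then have "card ((\<lambda>x. B n x y) ` E n) \<le> q n"
      using card_mono[OF assms(5)] assms(6) by metis
    moreover have "miss n y = real (q n) - real (card ((\<lambda>x. B n x y) ` E n))"
      using calculation sub finE[of n] by (simp add: miss_def card_Diff_subset assms(6) of_nat_diff)
    ultimately show ?thesis using y by (auto simp: image E'_def Z_def)
  qed
  show ?thesis
    by (intro exI[of _ E'] bexI[of _ \<delta>] bexI[of _ \<epsilon>] allI conjI ballI card_E' pinned \<delta>_lim \<epsilon>_lim)
       (auto simp: E'_def)
qed

end
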